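(* Let $X$, $Y$ be Banach spaces with $X\in\mathrm{ACK}_{\rho_X}$ and $Y\in\mathrm{ACK}_{\rho_Y}$, where $\rho_X,\rho_Y\in[0,1)$. Then $Z = X\bigoplus_\infty Y \in \mathrm{ACK}_{\rho}$ with $\rho= \max\{\rho_X, \rho_Y\}$. Moreover, $Z \in \mathrm{ACK}$ whenever $X, Y \in \mathrm{ACK}$.
   Context: Banach spaces are over $\mathbb{K}\in\{\mathbb{R},\mathbb{C}\}$. $X\bigoplus_\infty Y$ is $X\times Y$ with norm $\|(x,y)\|=\max\{\|x\|,\|y\|\}$. $B_X$, $S_X$ are the closed unit ball and unit sphere; $L(X)$ is the space of bounded linear operators on $X$; $w^*$ is the weak-star topology; $\mathrm{aco}\{0,V\}$ is the absolutely convex hull of $V\cup\{0\}$. A set $\Gamma\subset B_{X^*}$ is $1$-norming if $\|x\|=\sup_{x^*\in\Gamma}|x^*(x)|$ for all $x\in X$. ACK structure. For $\rho\in[0,1)$, $X\in\mathrm{ACK}_\rho$ if there is a $1$-norming set $\Gamma\subset B_{X^*}$ such that for every $\varepsilon>0$ and every non-empty relatively $w^*$-open $U\subset\Gamma$ there exist a non-empty $V\subset U$, vectors $x_1^*\in V$, $e\in S_X$ and an operator $F\in L(X)$ with: (I) $\|Fe\|=\|F\|=1$; (II) $x_1^*(Fe)=1$; (III) $F^*x_1^*=x_1^*$; (IV) denoting $V_1=\{x^*\in\Gamma:\|F^*x^*\|+(1-\varepsilon)\|(I_{X^*}-F^* )(x^* )\|\le 1\}$, one has $|v^*(Fe)|\le\rho$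 for every $v^*\in\Gamma\setminus V_1$; (V) $\mathrm{dist}(F^*x^*,\mathrm{aco}\{0,V\})<\varepsilon$ for every $x^*\in\Gamma$; (VI) $|v^*(e)-1|\le\varepsilon$ for every $v^*\in V$. $X\in\mathrm{ACK}$ (simple ACK structure) if the same holds with (IV) replaced by $V_1=\Gamma$. *)

theory Defs
  imports "HOL-Analysis.Analysis"
begin

section \<open>Banach spaces over the real or complex field\<close>

text \<open>
  A Banach space over a scalar field is a type of class \<open>banach\<close> together with a scalar
  multiplication by \<open>'k\<close> that extends the multiplication by reals and for which the norm is
  homogeneous. The instances of interest are \<open>'k = real\<close> (where \<open>sc\<close> is forced to
  be \<open>(*\<^sub>R)\<close>) and \<open>'k = complex\<close>; as the norm of a \<open>real_normed_field\<close> is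
  multiplicative, by Mazur's theorem these are the only ones up to isometric isomorphism.
\<close>

locale banach_over = vector_space sc
  for sc :: "'k::real_normed_field \<Rightarrow> 'a::banach \<Rightarrow> 'a" +
  assumes scale_of_real: "sc (of_real r) x = r *\<^sub>R x"
    and norm_scale: "norm (sc c x) = norm c * norm x"

text \<open>
  The type \<open>'a \<Rightarrow>\<^sub>L 'b\<close> consists of the real-linear bounded operators with the
  operator norm; linearity over \<open>'k\<close> is imposed in addition.
\<close>

definition dual :: "('k::real_normed_field \<Rightarrow> 'a::banach \<Rightarrow> 'a) \<Rightarrow> ('a \<Rightarrow>\<^sub>L 'k) set" where
  "dual sc = {f. \<forall>c x. blinfun_apply f (sc c x) = c * blinfun_apply f x}"

definition operators :: "('k::real_normed_field \<Rightarrow> 'a::banach \<Rightarrow> 'a) \<Rightarrow> ('a \<Rightarrow>\<^sub>L 'a) set" where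
  "operators sc = {F. \<forall>c x. blinfun_apply F (sc c x) = sc c (blinfun_apply F x)}"

definition adjoint_op ::
    "('a::real_normed_vector \<Rightarrow>\<^sub>L 'a) \<Rightarrow> ('a \<Rightarrow>\<^sub>L 'k::real_normed_field) \<Rightarrow> ('a \<Rightarrow>\<^sub>L 'k)" where
  "adjoint_op F f = f o\<^sub>L F"

definition weak_star ::
    "('k::real_normed_field \<Rightarrow> 'a::banach \<Rightarrow> 'a) \<Rightarrow> ('a \<Rightarrow>\<^sub>L 'k) topology" where
  "weak_star sc =
     topology_generated_by {{f \<in> dual sc. blinfun_apply f x \<in> W} | x W. open W}"

definition dual_scale ::
    "'k::real_normed_field \<Rightarrow> ('a::real_normed_vector \<Rightarrow>\<^sub>L 'k) \<Rightarrow> ('a \<Rightarrow>\<^sub>L 'k)" where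
  "dual_scale c f = blinfun_mult_right c o\<^sub>L f"

definition absolutely_convex :: "('a::real_normed_vector \<Rightarrow>\<^sub>L 'k::real_normed_field) set \<Rightarrow> bool" where
  "absolutely_convex S \<longleftrightarrow>
     convex S \<and> (\<forall>c. norm c \<le> 1 \<longrightarrow> (\<forall>f\<in>S. dual_scale c f \<in> S))"

text \<open>
  The set \<open>\<Gamma>\<close> is required to be non-empty since \<open>Sup {}\<close> is unspecified for
  reals; for a non-zero space this is automatic.
\<close>

definition one_norming ::
    "('k::real_normed_field \<Rightarrow> 'a::banach \<Rightarrow> 'a) \<Rightarrow> ('a \<Rightarrow>\<^sub>L 'k) set \<Rightarrow> bool" where
  "one_norming sc \<Gamma> \<longleftrightarrow>
     \<Gamma> \<noteq> {} \<and> \<Gamma> \<subseteq> dual sc \<inter> cball 0 1 \<and>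
     (\<forall>x. norm x = (SUP f\<in>\<Gamma>. norm (blinfun_apply f x)))"


section \<open>ACK structures\<close>

definition ACK_V1 ::
    "('a::banach \<Rightarrow>\<^sub>L 'k::real_normed_field) set \<Rightarrow> real \<Rightarrow> ('a \<Rightarrow>\<^sub>L 'a) \<Rightarrow> ('a \<Rightarrow>\<^sub>L 'k) set" where
  "ACK_V1 \<Gamma> \<epsilon> F =
     {f \<in> \<Gamma>. norm (adjoint_op F f) + (1 - \<epsilon>) * norm (f - adjoint_op F f) \<le> 1}"

text \<open>
  The requirements common to \<open>ACK_rho\<close> and \<open>ACK_simple\<close>, which differ only in what
  is asked of \<open>ACK_V1\<close>. The parameter of \<open>ACK_rho\<close> is meant to lie in \<open>[0, 1)\<close>.
\<close>

definition ACK_common ::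
    "('a::banach \<Rightarrow>\<^sub>L 'k::real_normed_field) set \<Rightarrow> real \<Rightarrow> ('a \<Rightarrow>\<^sub>L 'k) set \<Rightarrow>
     ('a \<Rightarrow>\<^sub>L 'k) \<Rightarrow> 'a \<Rightarrow> ('a \<Rightarrow>\<^sub>L 'a) \<Rightarrow> bool" where
  "ACK_common \<Gamma> \<epsilon> V x1 e F \<longleftrightarrow>
     norm (blinfun_apply F e) = 1 \<and> norm F = 1 \<and>
     blinfun_apply x1 (blinfun_apply F e) = 1 \<and>
     adjoint_op F x1 = x1 \<and>
     (\<forall>f\<in>\<Gamma>. infdist (adjoint_op F f) (absolutely_convex hull (insert 0 V)) < \<epsilon>) \<and>
     (\<forall>v\<in>V. norm (blinfun_apply v e - 1) \<le> \<epsilon>)"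

definition ACK_rho :: "('k::real_normed_field \<Rightarrow> 'a::banach \<Rightarrow> 'a) \<Rightarrow> real \<Rightarrow> bool" where
  "ACK_rho sc \<rho> \<longleftrightarrow>
     (\<exists>\<Gamma>. one_norming sc \<Gamma> \<and>
       (\<forall>\<epsilon>>0. \<forall>U. openin (subtopology (weak_star sc) \<Gamma>) U \<and> U \<noteq> {} \<longrightarrow>
         (\<exists>V x1 e F. V \<noteq> {} \<and> V \<subseteq> U \<and> x1 \<in> V \<and> e \<in> sphere 0 1 \<and> F \<in> operators sc \<and>
           ACK_common \<Gamma> \<epsilon> V x1 e F \<and>
           (\<forall>v \<in> \<Gamma> - ACK_V1 \<Gamma> \<epsilon> F. norm (blinfun_apply v (blinfun_apply F e)) \<le> \<rho>))))"

definition ACK_simple :: "('k::real_normed_field \<Rightarrow> 'a::banach \<Rightarrow> 'a) \<Rightarrow> bool" where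
  "ACK_simple sc \<longleftrightarrow>
     (\<exists>\<Gamma>. one_norming sc \<Gamma> \<and>
       (\<forall>\<epsilon>>0. \<forall>U. openin (subtopology (weak_star sc) \<Gamma>) U \<and> U \<noteq> {} \<longrightarrow>
         (\<exists>V x1 e F. V \<noteq> {} \<and> V \<subseteq> U \<and> x1 \<in> V \<and> e \<in> sphere 0 1 \<and> F \<in> operators sc \<and>
           ACK_common \<Gamma> \<epsilon> V x1 e F \<and>
           ACK_V1 \<Gamma> \<epsilon> F = \<Gamma>)))"


section \<open>The \<open>\<infinity>\<close>-sum of two spaces\<close>

text \<open>A type of its own, because the library's norm on \<open>'a \<times> 'b\<close> is the Euclidean one.\<close>

datatype ('a, 'b) max_sum = MaxSum (left: 'a) (right: 'b)

instantiation max_sum :: (real_normed_vector, real_normed_vector) real_normed_vector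
begin

definition zero_max_sum :: "('a, 'b) max_sum" where
  "0 = MaxSum 0 0"

definition plus_max_sum :: "('a, 'b) max_sum \<Rightarrow> ('a, 'b) max_sum \<Rightarrow> ('a, 'b) max_sum" where
  "z + w = MaxSum (left z + left w) (right z + right w)"

definition minus_max_sum :: "('a, 'b) max_sum \<Rightarrow> ('a, 'b) max_sum \<Rightarrow> ('a, 'b) max_sum" where
  "z - w = MaxSum (left z - left w) (right z - right w)"

definition uminus_max_sum :: "('a, 'b) max_sum \<Rightarrow> ('a, 'b) max_sum" where
  "- z = MaxSum (- left z) (- right z)"

definition scaleR_max_sum :: "real \<Rightarrow> ('a, 'b) max_sum \<Rightarrow> ('a, 'b) max_sum" where
  "r *\<^sub>R z = MaxSum (r *\<^sub>R left z) (r *\<^sub>R right z)"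

definition norm_max_sum :: "('a, 'b) max_sum \<Rightarrow> real" where
  "norm z = max (norm (left z)) (norm (right z))"

definition dist_max_sum :: "('a, 'b) max_sum \<Rightarrow> ('a, 'b) max_sum \<Rightarrow> real" where
  "dist_max_sum z w = norm (z - w)"

definition sgn_max_sum :: "('a, 'b) max_sum \<Rightarrow> ('a, 'b) max_sum" where
  "sgn_max_sum z = inverse (norm z) *\<^sub>R z"

definition uniformity_max_sum :: "(('a, 'b) max_sum \<times> ('a, 'b) max_sum) filter" where
  "uniformity_max_sum = (INF e\<in>{0<..}. principal {(z :: ('a, 'b) max_sum, w). dist z w < e})"

definition open_max_sum :: "('a, 'b) max_sum set \<Rightarrow> bool" where
  "open_max_sum U \<longleftrightarrow> (\<forall>z\<in>U. eventually (\<lambda>(z', w). z' = z \<longrightarrow> w \<in> U) uniformity)"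

instance
proof
  fix z w :: "('a, 'b) max_sum"
  show "norm (z + w) \<le> norm z + norm w"
    using norm_triangle_ineq[of "left z" "left w"] norm_triangle_ineq[of "right z" "right w"]
    by (auto simp: norm_max_sum_def plus_max_sum_def)
  show "norm z = 0 \<longleftrightarrow> z = 0"
    by (cases z) (auto simp: norm_max_sum_def zero_max_sum_def max_def)
  show "norm (r *\<^sub>R z) = \<bar>r\<bar> * norm z" for r
    by (simp add: norm_max_sum_def scaleR_max_sum_def max_mult_distrib_left)
qed (auto simp: zero_max_sum_def plus_max_sum_def minus_max_sum_def uminus_max_sum_def
    scaleR_max_sum_def dist_max_sum_def sgn_max_sum_def uniformity_max_sum_def open_max_sum_def
    algebra_simps)

end

instance max_sum :: (banach, banach) banach
proof
  fix X :: "nat \<Rightarrow> ('a, 'b) max_sum"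
  assume C: "Cauchy X"
  have dl: "dist (left z) (left w) \<le> dist z w" and dr: "dist (right z) (right w) \<le> dist z w"
    for z w :: "('a, 'b) max_sum"
    by (simp_all add: dist_max_sum_def norm_max_sum_def minus_max_sum_def dist_norm)
  have "Cauchy (\<lambda>n. left (X n))" "Cauchy (\<lambda>n. right (X n))"
    using C unfolding Cauchy_def by (meson dl dr le_less_trans)+
  then obtain a b where ab: "(\<lambda>n. left (X n)) \<longlonglongrightarrow> a" "(\<lambda>n. right (X n)) \<longlonglongrightarrow> b"
    by (auto dest!: Cauchy_convergent simp: convergent_def)
  have "(\<lambda>n. max (norm (left (X n) - a)) (norm (right (X n) - b))) \<longlonglongrightarrow> max 0 0"
    by (intro tendsto_max tendsto_norm_zero) (use ab in \<open>simp_all add: LIM_zero_iff\<close>)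
  then have "(\<lambda>n. dist (X n) (MaxSum a b)) \<longlonglongrightarrow> 0"
    by (simp add: dist_max_sum_def norm_max_sum_def minus_max_sum_def)
  then show "convergent X"
    by (auto simp: convergent_def intro: tendsto_dist_iff[THEN iffD2])
qed

definition max_sum_scale ::
    "('k \<Rightarrow> 'a \<Rightarrow> 'a) \<Rightarrow> ('k \<Rightarrow> 'b \<Rightarrow> 'b) \<Rightarrow> 'k \<Rightarrow> ('a, 'b) max_sum \<Rightarrow> ('a, 'b) max_sum" where
  "max_sum_scale scaleX scaleY c z = MaxSum (scaleX c (left z)) (scaleY c (right z))"

lemma banach_over_max_sum:
  assumes "banach_over scaleX" "banach_over scaleY"
  shows "banach_over (max_sum_scale scaleX scaleY)"
proof -
  interpret X: banach_over scaleX by fact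
  interpret Y: banach_over scaleY by fact
  show ?thesis
    by unfold_locales
      (auto simp: max_sum_scale_def plus_max_sum_def scaleR_max_sum_def norm_max_sum_def
        X.scale_right_distrib X.scale_left_distrib Y.scale_right_distrib Y.scale_left_distrib
        X.scale_of_real Y.scale_of_real X.norm_scale Y.norm_scale max_mult_distrib_left)
qed

lemma banach_over_real: "banach_over (scaleR :: real \<Rightarrow> 'a::banach \<Rightarrow> 'a)"
  by unfold_locales (auto simp: algebra_simps)

lemma banach_over_complex: "banach_over ((*) :: complex \<Rightarrow> complex \<Rightarrow> complex)"
  by unfold_locales (auto simp: algebra_simps norm_mult scaleR_conv_of_real)

end

theory Submission
  imports Defs
begin

text \<open>
  If \<open>\<Gamma>\<^sub>X\<close> and \<open>\<Gamma>\<^sub>Y\<close> carry the ACK structures of the summands, then the functionals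
  \<open>f \<circ> left\<close> with \<open>f \<in> \<Gamma>\<^sub>X\<close> and \<open>g \<circ> right\<close> with \<open>g \<in> \<Gamma>\<^sub>Y\<close> together form a
  1-norming set \<open>\<Gamma>\<close> for the \<open>\<infinity>\<close>-sum, because a supremum over a union is the maximum of the
  two suprema. A non-empty relatively weak-star open part \<open>U\<close> of \<open>\<Gamma>\<close> contains, say, some
  \<open>f \<circ> left\<close>. As \<open>f \<mapsto> f \<circ> left\<close> is weak-star continuous, the functionals of \<open>\<Gamma>\<^sub>X\<close> that it
  sends into \<open>U\<close> form a non-empty relatively open set, for which the structure of \<open>X\<close> provides
  \<open>V\<close>, \<open>x\<^sub>1\<close>, \<open>e\<close> and \<open>F\<close>. These are transported to the sum by letting \<open>F\<close> act on the first
  coordinate and annihilate the second one. For functionals that come from \<open>\<Gamma>\<^sub>X\<close> every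
  requirement is then the corresponding requirement in \<open>X\<close>, since \<open>f \<mapsto> f \<circ> left\<close> is an isometry
  intertwining the two adjoints. Functionals that come from \<open>\<Gamma>\<^sub>Y\<close> are annihilated by the
  adjoint of the new operator, so they satisfy the norm inequality that defines \<open>ACK_V1\<close>, and
  their images are at distance \<open>0\<close> from the hull.

  The two coordinates play symmetric roles, and all that matters about them is captured by the
  locale \<open>contractive_summand\<close>: a contractive projection \<open>P\<close> with a contractive right inverse
  \<open>J\<close>. The transport is carried out there once (\<open>ACK_witness_summand\<close>), and
  simultaneously for both kinds of ACK structure (\<open>ACK_structure\<close>).
\<close>

section \<open>Both kinds of ACK structure at once\<close>

text \<open>
  The two kinds of structure restrict the values \<open>|v (F e)|\<close> for \<open>v\<close> outside \<open>ACK_V1\<close>: in one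
  case they are at most \<open>\<rho>\<close>, in the other case there are no such \<open>v\<close>, that is, their values
  satisfy an unsatisfiable condition. The predicate \<open>R\<close> stands for either restriction.
\<close>

definition ACK_witness ::
    "('k::real_normed_field \<Rightarrow> 'a::banach \<Rightarrow> 'a) \<Rightarrow> (real \<Rightarrow> bool) \<Rightarrow> ('a \<Rightarrow>\<^sub>L 'k) set \<Rightarrow>
     real \<Rightarrow> ('a \<Rightarrow>\<^sub>L 'k) set \<Rightarrow> ('a \<Rightarrow>\<^sub>L 'k) \<Rightarrow> 'a \<Rightarrow> ('a \<Rightarrow>\<^sub>L 'a) \<Rightarrow> bool" where
  "ACK_witness sc R \<Gamma> \<epsilon> V x1 e F \<longleftrightarrow>
     x1 \<in> V \<and> e \<in> sphere 0 1 \<and> F \<in> operators sc \<and> ACK_common \<Gamma> \<epsilon> V x1 e F \<and>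
     (\<forall>v \<in> \<Gamma> - ACK_V1 \<Gamma> \<epsilon> F. R (norm (blinfun_apply v (blinfun_apply F e))))"

definition ACK_structure ::
    "('k::real_normed_field \<Rightarrow> 'a::banach \<Rightarrow> 'a) \<Rightarrow> (real \<Rightarrow> bool) \<Rightarrow> ('a \<Rightarrow>\<^sub>L 'k) set \<Rightarrow> bool" where
  "ACK_structure sc R \<Gamma> \<longleftrightarrow>
     one_norming sc \<Gamma> \<and>
     (\<forall>\<epsilon>>0. \<forall>U. openin (subtopology (weak_star sc) \<Gamma>) U \<and> U \<noteq> {} \<longrightarrow>
       (\<exists>V x1 e F. V \<subseteq> U \<and> ACK_witness sc R \<Gamma> \<epsilon> V x1 e F))"

lemma ACK_rho_iff: "ACK_rho sc \<rho> \<longleftrightarrow> (\<exists>\<Gamma>. ACK_structure sc (\<lambda>t. t \<le> \<rho>) \<Gamma>)"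
proof -
  have "(V \<noteq> {} \<and> V \<subseteq> U \<and> x1 \<in> V \<and> Q) \<longleftrightarrow> (V \<subseteq> U \<and> x1 \<in> V \<and> Q)"
    for V U :: "('b \<Rightarrow>\<^sub>L 'a) set" and x1 Q
    by blast
  then show ?thesis
    unfolding ACK_rho_def ACK_structure_def ACK_witness_def by simp
qed

lemma ACK_simple_iff: "ACK_simple sc \<longleftrightarrow> (\<exists>\<Gamma>. ACK_structure sc (\<lambda>_. False) \<Gamma>)"
proof -
  have "(V \<noteq> {} \<and> V \<subseteq> U \<and> x1 \<in> V \<and> Q) \<longleftrightarrow> (V \<subseteq> U \<and> x1 \<in> V \<and> Q)"
    for V U :: "('b \<Rightarrow>\<^sub>L 'a) set" and x1 Q
    by blast
  moreover have "ACK_V1 \<Gamma> \<epsilon> F = \<Gamma> \<longleftrightarrow> (\<forall>v \<in> \<Gamma> - ACK_V1 \<Gamma> \<epsilon> F. False)"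
    for \<Gamma> :: "('b \<Rightarrow>\<^sub>L 'a) set" and \<epsilon> F
    by (auto simp: ACK_V1_def)
  ultimately show ?thesis
    unfolding ACK_simple_def ACK_structure_def ACK_witness_def by simp
qed

lemma ACK_structure_mono:
  assumes "ACK_structure sc R \<Gamma>" and "\<And>t. R t \<Longrightarrow> R' t"
  shows "ACK_structure sc R' \<Gamma>"
proof -
  have "ACK_witness sc R' \<Gamma> \<epsilon> V x1 e F" if "ACK_witness sc R \<Gamma> \<epsilon> V x1 e F" for \<epsilon> V x1 e F
    using that assms(2) unfolding ACK_witness_def by blast
  then show ?thesis
    using assms(1) unfolding ACK_structure_def by meson
qed

lemma topspace_weak_star: "topspace (weak_star sc) = dual sc"
  unfolding weak_star_def topology_generated_by_topspace by blast

lemma one_norming_norm_le: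
  assumes "one_norming sc \<Gamma>" and "f \<in> \<Gamma>"
  shows "norm f \<le> 1"
  using assms by (auto simp: one_norming_def)

lemma one_norming_bdd_above:
  assumes "one_norming sc \<Gamma>"
  shows "bdd_above ((\<lambda>f. norm (blinfun_apply f x)) ` \<Gamma>)"
proof (rule bdd_aboveI2)
  fix f assume "f \<in> \<Gamma>"
  then have "norm f * norm x \<le> 1 * norm x"
    by (intro mult_right_mono one_norming_norm_le[OF assms]) auto
  then show "norm (blinfun_apply f x) \<le> norm x"
    using norm_blinfun[of f x] by simp
qed

section \<open>Transport from a contractively complemented summand\<close>

locale contractive_summand =
  fixes scZ :: "'k::real_normed_field \<Rightarrow> 'z::banach \<Rightarrow> 'z"
    and scX :: "'k \<Rightarrow> 'x::banach \<Rightarrow> 'x"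
    and P :: "'z \<Rightarrow>\<^sub>L 'x" and J :: "'x \<Rightarrow>\<^sub>L 'z"
  assumes P_J: "blinfun_apply P (blinfun_apply J x) = x"
    and P_contraction: "norm P \<le> 1" and J_contraction: "norm J \<le> 1"
    and P_scale: "blinfun_apply P (scZ c z) = scX c (blinfun_apply P z)"
    and J_scale: "blinfun_apply J (scX c x) = scZ c (blinfun_apply J x)"
begin

lemma norm_P_le: "norm (blinfun_apply P z) \<le> norm z"
  using norm_blinfun[of P z] mult_right_mono[OF P_contraction norm_ge_zero[of z]] by simp

lemma norm_J: "norm (blinfun_apply J x) = norm x"
  using norm_blinfun[of J x] mult_right_mono[OF J_contraction norm_ge_zero[of x]]
    norm_P_le[of "blinfun_apply J x"] by (simp add: P_J)

definition pullback :: "('x \<Rightarrow>\<^sub>L 'k) \<Rightarrow> ('z \<Rightarrow>\<^sub>L 'k)" where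
  "pullback f = f o\<^sub>L P"

definition extension :: "('x \<Rightarrow>\<^sub>L 'x) \<Rightarrow> ('z \<Rightarrow>\<^sub>L 'z)" where
  "extension F = J o\<^sub>L F o\<^sub>L P"

lemma pullback_apply [simp]: "blinfun_apply (pullback f) z = blinfun_apply f (blinfun_apply P z)"
  by (simp add: pullback_def)

lemma extension_apply [simp]:
  "blinfun_apply (extension F) z = blinfun_apply J (blinfun_apply F (blinfun_apply P z))"
  by (simp add: extension_def)

lemma pullback_0: "pullback 0 = 0"
  by (rule blinfun_eqI) simp

lemma pullback_diff: "pullback (f - g) = pullback f - pullback g"
  by (rule blinfun_eqI) (simp add: blinfun.diff_left)

lemma pullback_dual: "f \<in> dual scX \<Longrightarrow> pullback f \<in> dual scZ"
  by (simp add: dual_def P_scale)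

lemma extension_operators: "F \<in> operators scX \<Longrightarrow> extension F \<in> operators scZ"
  by (simp add: operators_def P_scale J_scale)

text \<open>The functional \<open>f\<close> is recovered from \<open>pullback f\<close> by composing with the contraction \<open>J\<close>.\<close>

lemma norm_pullback: "norm (pullback f) = norm f"
proof (rule antisym)
  show "norm (pullback f) \<le> norm f"
    unfolding pullback_def
    using norm_blinfun_compose[of f P] mult_left_mono[OF P_contraction norm_ge_zero[of f]] by simp
  have "f = pullback f o\<^sub>L J"
    by (rule blinfun_eqI) (simp add: P_J)
  then have "norm f \<le> norm (pullback f) * norm J"
    by (metis norm_blinfun_compose)
  also have "\<dots> \<le> norm (pullback f)"
    using mult_left_mono[OF J_contraction norm_ge_zero[of "pullback f"]] by simp
  finally show "norm f \<le> norm (pullback f)" .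
qed

lemma dist_pullback: "dist (pullback f) (pullback g) = dist f g"
  by (simp add: dist_norm norm_pullback flip: pullback_diff)

lemma adjoint_extension_pullback:
  "adjoint_op (extension F) (pullback f) = pullback (adjoint_op F f)"
  by (rule blinfun_eqI) (simp add: adjoint_op_def P_J)

lemma adjoint_extension_eq_0:
  assumes "g o\<^sub>L J = 0"
  shows "adjoint_op (extension F) g = 0"
proof (rule blinfun_eqI)
  have "blinfun_apply g (blinfun_apply J x) = 0" for x
    using arg_cong[OF assms, of "\<lambda>h. blinfun_apply h x"] by simp
  then show "blinfun_apply (adjoint_op (extension F) g) z = blinfun_apply 0 z" for z
    by (simp add: adjoint_op_def)
qed

text \<open>
  Evaluating \<open>pullback f\<close> at \<open>z\<close> is evaluating \<open>f\<close> at \<open>P z\<close>, so subbasic open sets pull back to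
  subbasic open sets.
\<close>

lemma continuous_map_pullback: "continuous_map (weak_star scX) (weak_star scZ) pullback"
proof -
  have "openin (weak_star scX) (pullback -` {f \<in> dual scZ. blinfun_apply f z \<in> W} \<inter> dual scX)"
    if "open W" for z W
  proof -
    have "pullback -` {f \<in> dual scZ. blinfun_apply f z \<in> W} \<inter> dual scX
        = {f \<in> dual scX. blinfun_apply f (blinfun_apply P z) \<in> W}"
      using pullback_dual by auto
    then show ?thesis
      unfolding weak_star_def using that by (auto intro!: topology_generated_by_Basis)
  qed
  moreover have "pullback ` dual scX \<subseteq> \<Union> {{f \<in> dual scZ. blinfun_apply f z \<in> W} | z W. open W}"
    using pullback_dual by blast
  ultimately show ?thesis
    unfolding weak_star_def[of scZ]
    by (intro continuous_on_generated_topo) (auto simp: topspace_weak_star)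
qed

lemma absolutely_convex_pullback_vimage:
  assumes "absolutely_convex K"
  shows "absolutely_convex (pullback -` K)"
proof -
  have "pullback (u *\<^sub>R f + v *\<^sub>R g) = u *\<^sub>R pullback f + v *\<^sub>R pullback g" for u v f g
    by (rule blinfun_eqI) (simp add: blinfun.add_left blinfun.scaleR_left)
  then have "convex (pullback -` K)"
    using assms by (auto simp: absolutely_convex_def convex_def)
  moreover have "pullback (dual_scale c f) = dual_scale c (pullback f)" for c f
    by (rule blinfun_eqI) (simp add: dual_scale_def)
  ultimately show ?thesis
    using assms by (auto simp: absolutely_convex_def)
qed

lemma pullback_hull_subset:
  "pullback ` (absolutely_convex hull (insert 0 V))
   \<subseteq> absolutely_convex hull (insert 0 (pullback ` V))"
proof (rule image_subsetI)
  fix f assume f: "f \<in> absolutely_convex hull (insert 0 V)"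
  have "pullback f \<in> K" if "absolutely_convex K" "insert 0 (pullback ` V) \<subseteq> K" for K
  proof -
    have "insert 0 V \<subseteq> pullback -` K"
      using that(2) by (auto simp: pullback_0)
    then show ?thesis
      using f absolutely_convex_pullback_vimage[OF that(1)] unfolding hull_def by blast
  qed
  then show "pullback f \<in> absolutely_convex hull (insert 0 (pullback ` V))"
    unfolding hull_def by blast
qed

lemma infdist_pullback_hull_le:
  "infdist (pullback f) (absolutely_convex hull (insert 0 (pullback ` V)))
   \<le> infdist f (absolutely_convex hull (insert 0 V))"
proof -
  let ?H = "absolutely_convex hull (insert 0 V)"
  have ne: "?H \<noteq> {}"
    using hull_subset[of "insert 0 V" absolutely_convex] by auto
  then have "infdist (pullback f) (absolutely_convex hull (insert 0 (pullback ` V)))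
      \<le> infdist (pullback f) (pullback ` ?H)"
    by (intro infdist_mono pullback_hull_subset) auto
  also have "\<dots> = infdist f ?H"
    using ne by (simp add: infdist_def image_image dist_pullback)
  finally show ?thesis .
qed

text \<open>
  On functionals pulled back from \<open>\<Gamma>\<close> the requirements for \<open>extension F\<close> are those for \<open>F\<close>,
  because pulling back is isometric and intertwines the adjoints. A further functional \<open>g\<close> of
  \<open>\<Delta>\<close> vanishes on the range of \<open>J\<close>, so the adjoint of \<open>extension F\<close> sends it to \<open>0\<close>. It belongs
  to \<open>ACK_V1\<close> because \<open>norm g \<le> 1\<close> and \<open>\<epsilon> > 0\<close>, and it satisfies the distance requirement
  because \<open>0\<close> lies in the hull.
\<close>

lemma ACK_witness_summand:
  assumes \<epsilon>: "\<epsilon> > 0"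
    and pull: "pullback ` \<Gamma> \<subseteq> \<Delta>"
    and rest: "\<And>g. g \<in> \<Delta> - pullback ` \<Gamma> \<Longrightarrow> g o\<^sub>L J = 0 \<and> norm g \<le> 1"
    and wit: "ACK_witness scX R \<Gamma> \<epsilon> V x1 e F"
  shows "ACK_witness scZ R \<Delta> \<epsilon> (pullback ` V) (pullback x1) (blinfun_apply J e) (extension F)"
proof -
  note wit = wit[unfolded ACK_witness_def ACK_common_def]
  have norm_e: "norm (blinfun_apply J e) = 1"
    and norm_Fe: "norm (blinfun_apply (extension F) (blinfun_apply J e)) = 1"
    using wit by (auto simp: norm_J P_J)
  have "norm (extension F) = 1"
  proof (rule antisym)
    show "norm (extension F) \<le> 1"
    proof (rule norm_blinfun_bound)
      fix z
      have "norm (blinfun_apply F (blinfun_apply P z)) \<le> norm (blinfun_apply P z)"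
        using norm_blinfun[of F "blinfun_apply P z"] wit by simp
      then show "norm (blinfun_apply (extension F) z) \<le> 1 * norm z"
        using norm_P_le[of z] by (simp add: norm_J)
    qed simp
    show "1 \<le> norm (extension F)"
      using norm_blinfun[of "extension F" "blinfun_apply J e"] norm_e norm_Fe by simp
  qed
  moreover have "adjoint_op (extension F) (pullback x1) = pullback x1"
    using wit by (simp add: adjoint_extension_pullback)
  moreover have "infdist (adjoint_op (extension F) g)
      (absolutely_convex hull (insert 0 (pullback ` V))) < \<epsilon>" if "g \<in> \<Delta>" for g
  proof (cases "g \<in> pullback ` \<Gamma>")
    case True
    then obtain f where f: "f \<in> \<Gamma>" "g = pullback f"
      by blast
    then have "infdist (adjoint_op F f) (absolutely_convex hull (insert 0 V)) < \<epsilon>"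
      using wit by blast
    then show ?thesis
      using infdist_pullback_hull_le[of "adjoint_op F f" V]
      by (simp add: f adjoint_extension_pullback)
  next
    case False
    then have "adjoint_op (extension F) g = 0"
      using that rest adjoint_extension_eq_0 by blast
    moreover have "0 \<in> absolutely_convex hull (insert 0 (pullback ` V))"
      using hull_subset[of "insert 0 (pullback ` V)" absolutely_convex] by auto
    ultimately show ?thesis
      using \<epsilon> by simp
  qed
  ultimately have common:
    "ACK_common \<Delta> \<epsilon> (pullback ` V) (pullback x1) (blinfun_apply J e) (extension F)"
    using wit norm_Fe by (auto simp: ACK_common_def P_J)
  have "R (norm (blinfun_apply g (blinfun_apply (extension F) (blinfun_apply J e))))"
    if g: "g \<in> \<Delta> - ACK_V1 \<Delta> \<epsilon> (extension F)" for g
  proof (cases "g \<in> pullback ` \<Gamma>")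
    case True
    then obtain f where f: "f \<in> \<Gamma>" "g = pullback f"
      by blast
    then have "f \<notin> ACK_V1 \<Gamma> \<epsilon> F"
      using g by (auto simp: ACK_V1_def adjoint_extension_pullback norm_pullback
          simp flip: pullback_diff)
    then show ?thesis
      using f wit by (simp add: P_J)
  next
    case False
    then have g': "adjoint_op (extension F) g = 0" "norm g \<le> 1"
      using g rest adjoint_extension_eq_0 by blast+
    have "(1 - \<epsilon>) * norm g \<le> 1 * norm g"
      using \<epsilon> by (intro mult_right_mono) auto
    then have "g \<in> ACK_V1 \<Delta> \<epsilon> (extension F)"
      using g g' by (auto simp: ACK_V1_def)
    then show ?thesis
      using g by blast
  qed
  then show ?thesis
    using common wit norm_e extension_operators unfolding ACK_witness_def by simp
qed

lemma ACK_structure_summand: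
  assumes struct: "ACK_structure scX R \<Gamma>"
    and \<epsilon>: "\<epsilon> > 0"
    and pull: "pullback ` \<Gamma> \<subseteq> \<Delta>"
    and rest: "\<And>g. g \<in> \<Delta> - pullback ` \<Gamma> \<Longrightarrow> g o\<^sub>L J = 0 \<and> norm g \<le> 1"
    and U: "openin (subtopology (weak_star scZ) \<Delta>) U" "U \<inter> pullback ` \<Gamma> \<noteq> {}"
  obtains V x1 e F where "V \<subseteq> U" "ACK_witness scZ R \<Delta> \<epsilon> V x1 e F"
proof -
  have "continuous_map (subtopology (weak_star scX) \<Gamma>) (subtopology (weak_star scZ) \<Delta>) pullback"
    using pull continuous_map_from_subtopology[OF continuous_map_pullback]
    by (auto simp: continuous_map_in_subtopology)
  from openin_continuous_map_preimage[OF this U(1)]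
  have "openin (subtopology (weak_star scX) \<Gamma>)
      {f \<in> topspace (subtopology (weak_star scX) \<Gamma>). pullback f \<in> U}" .
  moreover have "topspace (subtopology (weak_star scX) \<Gamma>) = \<Gamma>"
    using struct by (auto simp: topspace_weak_star ACK_structure_def one_norming_def)
  ultimately have "openin (subtopology (weak_star scX) \<Gamma>) {f \<in> \<Gamma>. pullback f \<in> U}"
    by (simp only:)
  moreover have "{f \<in> \<Gamma>. pullback f \<in> U} \<noteq> {}"
    using U(2) by blast
  ultimately obtain V x1 e F where
    V: "V \<subseteq> {f \<in> \<Gamma>. pullback f \<in> U}" and wit: "ACK_witness scX R \<Gamma> \<epsilon> V x1 e F"
    using struct \<epsilon> unfolding ACK_structure_def by meson
  show ?thesis
  proof (rule that)
    show "pullback ` V \<subseteq> U"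
      using V by blast
  qed (rule ACK_witness_summand[OF \<epsilon> pull rest wit])
qed

end

section \<open>The \<open>\<infinity>\<close>-sum\<close>

definition left_proj :: "('a::banach, 'b::banach) max_sum \<Rightarrow>\<^sub>L 'a" where
  "left_proj = Blinfun left"

definition right_proj :: "('a::banach, 'b::banach) max_sum \<Rightarrow>\<^sub>L 'b" where
  "right_proj = Blinfun right"

definition left_inj :: "'a::banach \<Rightarrow>\<^sub>L ('a, 'b::banach) max_sum" where
  "left_inj = Blinfun (\<lambda>x. MaxSum x 0)"

definition right_inj :: "'b::banach \<Rightarrow>\<^sub>L ('a::banach, 'b) max_sum" where
  "right_inj = Blinfun (\<lambda>y. MaxSum 0 y)"

lemmas max_sum_simps = norm_max_sum_def plus_max_sum_def scaleR_max_sum_def zero_max_sum_def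

lemma left_proj_apply [simp]:
  fixes z :: "('a::banach, 'b::banach) max_sum"
  shows "blinfun_apply left_proj z = left z"
proof -
  have "bounded_linear (left :: ('a, 'b) max_sum \<Rightarrow> 'a)"
    by (rule bounded_linear_intro[where K = 1]) (auto simp: max_sum_simps)
  then show ?thesis by (simp add: left_proj_def bounded_linear_Blinfun_apply)
qed

lemma right_proj_apply [simp]:
  fixes z :: "('a::banach, 'b::banach) max_sum"
  shows "blinfun_apply right_proj z = right z"
proof -
  have "bounded_linear (right :: ('a, 'b) max_sum \<Rightarrow> 'b)"
    by (rule bounded_linear_intro[where K = 1]) (auto simp: max_sum_simps)
  then show ?thesis by (simp add: right_proj_def bounded_linear_Blinfun_apply)
qed

lemma left_inj_apply [simp]:
  "blinfun_apply (left_inj :: 'a::banach \<Rightarrow>\<^sub>L ('a, 'b::banach) max_sum) x = MaxSum x 0"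
proof -
  have "bounded_linear (\<lambda>x::'a. MaxSum x (0::'b))"
    by (rule bounded_linear_intro[where K = 1]) (auto simp: max_sum_simps)
  then show ?thesis by (simp add: left_inj_def bounded_linear_Blinfun_apply)
qed

lemma right_inj_apply [simp]:
  "blinfun_apply (right_inj :: 'b::banach \<Rightarrow>\<^sub>L ('a::banach, 'b) max_sum) y = MaxSum 0 y"
proof -
  have "bounded_linear (\<lambda>y::'b. MaxSum (0::'a) y)"
    by (rule bounded_linear_intro[where K = 1]) (auto simp: max_sum_simps)
  then show ?thesis by (simp add: right_inj_def bounded_linear_Blinfun_apply)
qed

lemma contractive_summand_left:
  fixes scaleX :: "'k::real_normed_field \<Rightarrow> 'a::banach \<Rightarrow> 'a"
    and scaleY :: "'k \<Rightarrow> 'b::banach \<Rightarrow> 'b"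
  assumes "banach_over scaleX" and "banach_over scaleY"
  shows "contractive_summand (max_sum_scale scaleX scaleY) scaleX left_proj left_inj"
proof -
  interpret Y: banach_over scaleY by fact
  show ?thesis
  proof
    show "norm (left_proj :: ('a, 'b) max_sum \<Rightarrow>\<^sub>L 'a) \<le> 1"
      by (rule norm_blinfun_bound) (auto simp: norm_max_sum_def)
    show "norm (left_inj :: 'a \<Rightarrow>\<^sub>L ('a, 'b) max_sum) \<le> 1"
      by (rule norm_blinfun_bound) (auto simp: norm_max_sum_def)
  qed (simp_all add: max_sum_scale_def)
qed

lemma contractive_summand_right:
  fixes scaleX :: "'k::real_normed_field \<Rightarrow> 'a::banach \<Rightarrow> 'a"
    and scaleY :: "'k \<Rightarrow> 'b::banach \<Rightarrow> 'b"
  assumes "banach_over scaleX" and "banach_over scaleY"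
  shows "contractive_summand (max_sum_scale scaleX scaleY) scaleY right_proj right_inj"
proof -
  interpret X: banach_over scaleX by fact
  show ?thesis
  proof
    show "norm (right_proj :: ('a, 'b) max_sum \<Rightarrow>\<^sub>L 'b) \<le> 1"
      by (rule norm_blinfun_bound) (auto simp: norm_max_sum_def)
    show "norm (right_inj :: 'b \<Rightarrow>\<^sub>L ('a, 'b) max_sum) \<le> 1"
      by (rule norm_blinfun_bound) (auto simp: norm_max_sum_def)
  qed (simp_all add: max_sum_scale_def)
qed

lemma ACK_structure_max_sum:
  fixes scaleX :: "'k::real_normed_field \<Rightarrow> 'a::banach \<Rightarrow> 'a"
    and scaleY :: "'k \<Rightarrow> 'b::banach \<Rightarrow> 'b"
  assumes "banach_over scaleX" and "banach_over scaleY"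
    and SX: "ACK_structure scaleX R \<Gamma>X" and SY: "ACK_structure scaleY R \<Gamma>Y"
  shows "ACK_structure (max_sum_scale scaleX scaleY) R
           ((\<lambda>f. f o\<^sub>L left_proj) ` \<Gamma>X \<union> (\<lambda>g. g o\<^sub>L right_proj) ` \<Gamma>Y)"
proof -
  let ?sc = "max_sum_scale scaleX scaleY"
  interpret X: contractive_summand ?sc scaleX left_proj left_inj
    by (rule contractive_summand_left) fact+
  interpret Y: contractive_summand ?sc scaleY right_proj right_inj
    by (rule contractive_summand_right) fact+
  define \<Gamma> where "\<Gamma> = X.pullback ` \<Gamma>X \<union> Y.pullback ` \<Gamma>Y"
  have NX: "one_norming scaleX \<Gamma>X" and NY: "one_norming scaleY \<Gamma>Y"
    using SX SY by (auto simp: ACK_structure_def)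
  have "one_norming ?sc \<Gamma>"
    unfolding one_norming_def
  proof (intro conjI allI)
    show "\<Gamma> \<noteq> {}"
      using NX by (auto simp: \<Gamma>_def one_norming_def)
    show "\<Gamma> \<subseteq> dual ?sc \<inter> cball 0 1"
      using NX NY
      by (auto simp: \<Gamma>_def one_norming_def X.norm_pullback Y.norm_pullback
          intro!: X.pullback_dual Y.pullback_dual)
    fix z
    have "(SUP f\<in>\<Gamma>. norm (blinfun_apply f z))
        = sup (SUP f\<in>X.pullback ` \<Gamma>X. norm (blinfun_apply f z))
            (SUP f\<in>Y.pullback ` \<Gamma>Y. norm (blinfun_apply f z))"
      unfolding \<Gamma>_def
      using NX NY one_norming_bdd_above[OF NX, of "left z"] one_norming_bdd_above[OF NY, of "right z"]
      by (intro cSUP_union) (auto simp: one_norming_def image_image)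
    also have "\<dots> = max (norm (left z)) (norm (right z))"
      using NX NY by (simp add: one_norming_def image_image sup_max)
    finally show "norm z = (SUP f\<in>\<Gamma>. norm (blinfun_apply f z))"
      by (simp add: norm_max_sum_def)
  qed
  moreover have "\<exists>V x1 e F. V \<subseteq> U \<and> ACK_witness ?sc R \<Gamma> \<epsilon> V x1 e F"
    if "\<epsilon> > 0" and U: "openin (subtopology (weak_star ?sc) \<Gamma>) U" "U \<noteq> {}" for \<epsilon> U
  proof -
    have vanish: "Y.pullback g o\<^sub>L left_inj = 0" "X.pullback f o\<^sub>L right_inj = 0" for f g
      by (rule blinfun_eqI, simp)+
    have norm_le: "norm h \<le> 1" if "h \<in> \<Gamma>" for h
      using that one_norming_norm_le[OF NX] one_norming_norm_le[OF NY]
      by (auto simp: \<Gamma>_def X.norm_pullback Y.norm_pullback)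
    have restX: "h o\<^sub>L left_inj = 0 \<and> norm h \<le> 1" if "h \<in> \<Gamma> - X.pullback ` \<Gamma>X" for h
      using that vanish norm_le by (auto simp: \<Gamma>_def)
    have restY: "h o\<^sub>L right_inj = 0 \<and> norm h \<le> 1" if "h \<in> \<Gamma> - Y.pullback ` \<Gamma>Y" for h
      using that vanish norm_le by (auto simp: \<Gamma>_def)
    have "U \<subseteq> \<Gamma>"
      using openin_subset[OF U(1)] by simp
    then consider "U \<inter> X.pullback ` \<Gamma>X \<noteq> {}" | "U \<inter> Y.pullback ` \<Gamma>Y \<noteq> {}"
      using U(2) unfolding \<Gamma>_def by blast
    then show ?thesis
    proof cases
      case 1
      show ?thesis
        by (rule X.ACK_structure_summand[OF SX \<open>\<epsilon> > 0\<close> _ restX U(1) 1]) (auto simp: \<Gamma>_def)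
    next
      case 2
      show ?thesis
        by (rule Y.ACK_structure_summand[OF SY \<open>\<epsilon> > 0\<close> _ restY U(1) 2]) (auto simp: \<Gamma>_def)
    qed
  qed
  ultimately have "ACK_structure ?sc R \<Gamma>"
    by (simp add: ACK_structure_def)
  then show ?thesis
    by (simp add: \<Gamma>_def X.pullback_def[abs_def] Y.pullback_def[abs_def])
qed

theorem theorem4p11:
  fixes scaleX :: "'k::real_normed_field \<Rightarrow> 'a::banach \<Rightarrow> 'a"
    and scaleY :: "'k \<Rightarrow> 'b::banach \<Rightarrow> 'b"
  assumes "banach_over scaleX" and "banach_over scaleY"
  shows "(\<forall>\<rho>X \<rho>Y. 0 \<le> \<rho>X \<and> \<rho>X < 1 \<and> 0 \<le> \<rho>Y \<and> \<rho>Y < 1 \<and>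
            ACK_rho scaleX \<rho>X \<and> ACK_rho scaleY \<rho>Y \<longrightarrow>
            ACK_rho (max_sum_scale scaleX scaleY) (max \<rho>X \<rho>Y)) \<and>
         (ACK_simple scaleX \<and> ACK_simple scaleY \<longrightarrow>
            ACK_simple (max_sum_scale scaleX scaleY))"
proof (intro conjI allI impI)
  fix \<rho>X \<rho>Y :: real
  assume "0 \<le> \<rho>X \<and> \<rho>X < 1 \<and> 0 \<le> \<rho>Y \<and> \<rho>Y < 1 \<and> ACK_rho scaleX \<rho>X \<and> ACK_rho scaleY \<rho>Y"
  then obtain \<Gamma>X \<Gamma>Y where
    "ACK_structure scaleX (\<lambda>t. t \<le> \<rho>X) \<Gamma>X" "ACK_structure scaleY (\<lambda>t. t \<le> \<rho>Y) \<Gamma>Y"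
    by (auto simp: ACK_rho_iff)
  then have "ACK_structure scaleX (\<lambda>t. t \<le> max \<rho>X \<rho>Y) \<Gamma>X"
    "ACK_structure scaleY (\<lambda>t. t \<le> max \<rho>X \<rho>Y) \<Gamma>Y"
    by (auto elim!: ACK_structure_mono)
  then show "ACK_rho (max_sum_scale scaleX scaleY) (max \<rho>X \<rho>Y)"
    using ACK_structure_max_sum[OF assms] unfolding ACK_rho_iff by blast
next
  assume "ACK_simple scaleX \<and> ACK_simple scaleY"
  then show "ACK_simple (max_sum_scale scaleX scaleY)"
    using ACK_structure_max_sum[OF assms] unfolding ACK_simple_iff by blast
qed

end
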